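(* Let $\mathcal{C}$ be a unital $C^*$-algebra and let $\mathcal{D}\subseteq\mathcal{C}$ be an abelian $C^*$-subalgebra containing the unit of $\mathcal{C}$. If $v\in\mathcal{C}$ is an intertwiner for $\mathcal{D}$, then $v^*v,\ vv^*\in\mathcal{D}'\cap\mathcal{C}$. If $\mathcal{D}$ is maximal abelian in $\mathcal{C}$, then $v$ is a normalizer of $\mathcal{D}$.
   Context: A nonzero element $v\in\mathcal{C}$ is an intertwiner for $\mathcal{D}$ if $v\mathcal{D}=\mathcal{D}v$ as sets. An element $v\in\mathcal{C}$ is a normalizer of $\mathcal{D}$ if $v\mathcal{D}v^*\cup v^*\mathcal{D}v\subseteq\mathcal{D}$. $\mathcal{D}'$ denotes the commutant of $\mathcal{D}$. *)

theory Defs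
  imports "HOL-Analysis.Analysis"
begin

(* Real scalars come from the superclasses; scaleR_scaleC makes the complex scalar
   multiplication extend them, and with it 1 acts as the identity.  The superclass
   axioms 0 \<noteq> 1 and norm 1 = 1 exclude only the zero algebra. *)
class unital_cstar_algebra = real_normed_algebra_1 + banach +
  fixes scaleC :: "complex \<Rightarrow> 'a \<Rightarrow> 'a"
    and star :: "'a \<Rightarrow> 'a"
  assumes scaleR_scaleC: "scaleR r x = scaleC (complex_of_real r) x"
    and scaleC_add_right: "scaleC c (x + y) = scaleC c x + scaleC c y"
    and scaleC_add_left: "scaleC (c + d) x = scaleC c x + scaleC d x"
    and scaleC_scaleC: "scaleC c (scaleC d x) = scaleC (c * d) x"
    and mult_scaleC_left: "scaleC c x * y = scaleC c (x * y)"
    and mult_scaleC_right: "x * scaleC c y = scaleC c (x * y)"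
    and norm_scaleC: "norm (scaleC c x) = cmod c * norm x"
    and star_add: "star (x + y) = star x + star y"
    and star_scaleC: "star (scaleC c x) = scaleC (cnj c) (star x)"
    and star_mult: "star (x * y) = star y * star x"
    and star_star: "star (star x) = x"
    and cstar_identity: "norm (star x * x) = (norm x)\<^sup>2"

instantiation complex :: unital_cstar_algebra
begin

definition scaleC_complex :: "complex \<Rightarrow> complex \<Rightarrow> complex" where
  "scaleC_complex c x = c * x"

definition star_complex :: "complex \<Rightarrow> complex" where
  "star_complex = cnj"

instance
  by standard
    (simp_all add: scaleC_complex_def star_complex_def scaleR_conv_of_real
      algebra_simps norm_mult power2_eq_square)

end

definition cstar_subalgebra :: "'a::unital_cstar_algebra set \<Rightarrow> bool" where
  "cstar_subalgebra D \<longleftrightarrow>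
     0 \<in> D \<and>
     (\<forall>x\<in>D. \<forall>y\<in>D. x + y \<in> D) \<and>
     (\<forall>c. \<forall>x\<in>D. scaleC c x \<in> D) \<and>
     (\<forall>x\<in>D. \<forall>y\<in>D. x * y \<in> D) \<and>
     (\<forall>x\<in>D. star x \<in> D) \<and>
     closed D"

definition abelian :: "'a::unital_cstar_algebra set \<Rightarrow> bool" where
  "abelian D \<longleftrightarrow> (\<forall>x\<in>D. \<forall>y\<in>D. x * y = y * x)"

definition maximal_abelian :: "'a::unital_cstar_algebra set \<Rightarrow> bool" where
  "maximal_abelian D \<longleftrightarrow>
     cstar_subalgebra D \<and> abelian D \<and>
     (\<forall>E. cstar_subalgebra E \<and> abelian E \<and> D \<subseteq> E \<longrightarrow> E = D)"

(* The ambient algebra is the whole type, so this is the relative commutant. *)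
definition commutant :: "'a::unital_cstar_algebra set \<Rightarrow> 'a set" where
  "commutant D = {x. \<forall>d\<in>D. x * d = d * x}"

definition intertwiner :: "'a::unital_cstar_algebra set \<Rightarrow> 'a \<Rightarrow> bool" where
  "intertwiner D v \<longleftrightarrow> v \<noteq> 0 \<and> (\<lambda>d. v * d) ` D = (\<lambda>d. d * v) ` D"

definition normalizer :: "'a::unital_cstar_algebra set \<Rightarrow> 'a \<Rightarrow> bool" where
  "normalizer D v \<longleftrightarrow>
     (\<lambda>d. v * d * star v) ` D \<union> (\<lambda>d. star v * d * v) ` D \<subseteq> D"

end

theory Submission
  imports Defs
begin

text \<open>
  Let \<open>d \<in> D\<close> and write \<open>v d = e v\<close> with \<open>e \<in> D\<close>. Taking adjoints gives
  \<open>d\<^sup>* v\<^sup>* = v\<^sup>* e\<^sup>*\<close>, which speaks about \<open>d\<^sup>*\<close> and \<open>e\<^sup>*\<close> instead of \<open>d\<close> and \<open>e\<close>. The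
  Fuglede--Putnam theorem repairs this: since \<open>D\<close> is abelian, \<open>d\<close> and \<open>e\<close> are normal, so also
  \<open>v d\<^sup>* = e\<^sup>* v\<close>, whose adjoint is \<open>d v\<^sup>* = v\<^sup>* e\<close>. Hence
  \<open>v\<^sup>* v d = v\<^sup>* e v = d v\<^sup>* v\<close>, and symmetrically for \<open>v v\<^sup>*\<close>.

  If \<open>D\<close> is maximal abelian, it contains every self-adjoint element \<open>h\<close> commuting with it, because
  the double commutant of \<open>D \<union> {h}\<close> is an abelian \<open>C\<^sup>*\<close>-subalgebra. So \<open>v\<^sup>* v\<close> and \<open>v v\<^sup>*\<close> lie in
  \<open>D\<close>, and \<open>v d v\<^sup>* = e (v v\<^sup>*) \<in> D\<close>; likewise for \<open>v\<^sup>* d v\<close>.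

  The analytic work is in Fuglede--Putnam, proved by Rosenblum's argument: if \<open>N v = v M\<close> with \<open>N\<close> and
  \<open>M\<close> normal, then \<open>z \<mapsto> exp (z N\<^sup>*) v exp (- z M\<^sup>*)\<close> is entire and bounded, so the coefficient
  \<open>N\<^sup>* v - v M\<^sup>*\<close> of \<open>z\<close> vanishes. The instance of Liouville's theorem for algebra-valued power
  series that this needs is obtained from Cauchy estimates, with the mean over a circle replaced by
  the mean over roots of unity (\<open>polynomial_Cauchy_estimate\<close>).
\<close>

section \<open>Complex scalars and the involution\<close>

lemma scaleC_one: "scaleC 1 (x::'a::unital_cstar_algebra) = x"
  using scaleR_scaleC[of 1 x] by simp

lemma scaleC_zero_left: "scaleC 0 (x::'a::unital_cstar_algebra) = 0"
  using scaleR_scaleC[of 0 x] by simp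

lemma scaleC_sum_left:
  "scaleC (sum f A) (x::'a::unital_cstar_algebra) = (\<Sum>i\<in>A. scaleC (f i) x)"
  by (induction A rule: infinite_finite_induct)
    (simp_all add: scaleC_zero_left scaleC_add_left)

lemma scaleC_zero_right: "scaleC c (0::'a::unital_cstar_algebra) = 0"
  using scaleC_scaleC[of c 0 "0::'a"] by (simp add: scaleC_zero_left)

lemma scaleC_minus_right: "scaleC c (- x) = - scaleC c (x::'a::unital_cstar_algebra)"
  using scaleC_add_right[of c "- x" x] by (simp add: scaleC_zero_right eq_neg_iff_add_eq_0)

lemma scaleC_diff_right:
  "scaleC c (x - y) = scaleC c x - scaleC c (y::'a::unital_cstar_algebra)"
  using scaleC_add_right[of c x "- y"] by (simp add: scaleC_minus_right)

lemma scaleC_sum_right: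
  "scaleC c (\<Sum>i\<in>A. f i) = (\<Sum>i\<in>A. scaleC c (f i :: 'a::unital_cstar_algebra))"
  by (induction A rule: infinite_finite_induct)
    (simp_all add: scaleC_zero_right scaleC_add_right)

lemma scaleC_power:
  "scaleC c (x::'a::unital_cstar_algebra) ^ n = scaleC (c ^ n) (x ^ n)"
  by (induction n)
    (simp_all add: scaleC_one mult_scaleC_left mult_scaleC_right scaleC_scaleC mult.commute)

lemma star_scaleR: "star (r *\<^sub>R x) = r *\<^sub>R star (x::'a::unital_cstar_algebra)"
  by (simp add: scaleR_scaleC star_scaleC)

lemma star_minus: "star (- x) = - star (x::'a::unital_cstar_algebra)"
  using star_scaleR[of "-1" x] by simp

lemma star_diff: "star (x - y) = star x - star (y::'a::unital_cstar_algebra)"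
  using star_add[of x "- y"] by (simp add: star_minus)

lemma star_one: "star (1::'a::unital_cstar_algebra) = 1"
  using star_mult[of "star 1" "1::'a"] by (simp add: star_star)

lemma star_power: "star (x ^ n) = star (x::'a::unital_cstar_algebra) ^ n"
  by (induction n) (simp_all add: star_one star_mult power_commutes)

lemma norm_le_norm_star: "norm x \<le> norm (star (x::'a::unital_cstar_algebra))"
proof (cases "x = 0")
  case False
  have "norm x * norm x \<le> norm (star x) * norm x"
    using norm_mult_ineq[of "star x" x] by (simp add: cstar_identity power2_eq_square)
  with False show ?thesis by simp
qed simp

lemma norm_star: "norm (star x) = norm (x::'a::unital_cstar_algebra)"
  using norm_le_norm_star[of x] norm_le_norm_star[of "star x"] by (simp add: star_star)

lemma bounded_linear_star: "bounded_linear (star :: 'a::unital_cstar_algebra \<Rightarrow> 'a)"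
  by (rule bounded_linear_intro[where K = 1]) (simp_all add: star_add star_scaleR norm_star)

lemma star_exp: "star (exp x) = exp (star (x::'a::unital_cstar_algebra))"
proof -
  have "(\<lambda>n. star (x ^ n /\<^sub>R fact n)) sums star (exp x)"
    by (rule bounded_linear.sums[OF bounded_linear_star exp_converges])
  hence "(\<lambda>n. star x ^ n /\<^sub>R fact n) sums star (exp x)"
    by (simp add: star_scaleR star_power)
  thus ?thesis using exp_converges sums_unique2 by blast
qed

text \<open>The exponential of a skew-adjoint element is unitary, and the \<open>C\<^sup>*\<close>-identity gives its norm.\<close>

lemma norm_exp_skew_adjoint:
  assumes "star s = - (s::'a::unital_cstar_algebra)"
  shows "norm (exp s) = 1"
proof -
  have "star (exp s) * exp s = 1"
    using exp_minus_inverse[of "- s"] by (simp add: star_exp assms)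
  hence "(norm (exp s))\<^sup>2 = 1" using cstar_identity[of "exp s"] by simp
  thus ?thesis using norm_ge_zero[of "exp s"] by (simp add: power2_eq_1_iff)
qed

lemma exp_intertwine:
  fixes a b v :: "'a::{real_normed_algebra_1,banach}"
  assumes "a * v = v * b"
  shows "exp a * v = v * exp b"
proof -
  have pow: "a ^ n * v = v * b ^ n" for n
  proof (induction n)
    case (Suc n)
    have "a ^ Suc n * v = a * (a ^ n * v)" by (simp add: mult.assoc)
    also have "\<dots> = a * v * b ^ n" by (simp add: Suc mult.assoc)
    finally show ?case by (simp add: assms mult.assoc)
  qed simp
  have "(\<lambda>n. a ^ n /\<^sub>R fact n * v) sums (exp a * v)"
    by (rule sums_mult2[OF exp_converges])
  moreover have "(\<lambda>n. v * (b ^ n /\<^sub>R fact n)) sums (v * exp b)"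
    by (rule sums_mult[OF exp_converges])
  ultimately show ?thesis by (simp add: pow sums_unique2)
qed

section \<open>Bounded entire power series\<close>

lemma sum_powers_root_of_unity:
  fixes w :: complex
  assumes "w ^ K = 1" "w \<noteq> 1"
  shows "(\<Sum>j<K. w ^ j) = 0"
  using geometric_sum[OF assms(2), of K] assms by simp

text \<open>
  The coefficient is recovered exactly by discrete Fourier inversion: for a primitive \<open>K\<close>-th root of
  unity \<open>w\<close> and a polynomial \<open>P\<close> of degree below \<open>K\<close>, the mean of \<open>w\<^bsup>-jm\<^esup> P (r w\<^sup>j)\<close> over \<open>j < K\<close> is
  \<open>r\<^sup>m c\<^sub>m\<close>.
\<close>

lemma polynomial_Cauchy_estimate:
  fixes c :: "nat \<Rightarrow> 'a::unital_cstar_algebra"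
  assumes "m < K" "r \<ge> 0"
    and bound: "\<And>z. cmod z = r \<Longrightarrow> norm (\<Sum>n<K. scaleC (z ^ n) (c n)) \<le> B"
  shows "r ^ m * norm (c m) \<le> B"
proof -
  define w where "w = cis (2 * pi / real K)"
  have K: "K > 0" using assms(1) by simp
  have orth: "(\<Sum>j<K. inverse (w ^ j) ^ m * (w ^ j) ^ n) = (if n = m then of_nat K else 0)"
    if "n < K" for n
  proof -
    define q where "q = inverse (w ^ m) * w ^ n"
    have w0: "w \<noteq> 0" by (simp add: w_def)
    have wK: "w ^ K = 1" using K by (simp add: w_def Complex.DeMoivre)
    have summand: "inverse (w ^ j) ^ m * (w ^ j) ^ n = q ^ j" for j
      unfolding q_def power_mult_distrib power_inverse
      by (simp add: power_mult[symmetric] mult.commute)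
    have qK: "q ^ K = 1"
      unfolding q_def power_mult_distrib power_inverse
      by (simp add: power_mult[symmetric] mult.commute[of _ K]) (simp add: power_mult wK)
    have q1: "q = 1 \<longleftrightarrow> n = m"
    proof
      assume "q = 1"
      hence "w ^ n = w ^ m" using w0 by (simp add: q_def field_simps)
      moreover have "inj_on (\<lambda>k. cis (2 * pi * real k / real K)) {..<K}"
        using Complex.bij_betw_roots_unity[OF K] by (simp add: bij_betw_def)
      ultimately show "n = m"
        using that assms(1) by (auto simp: w_def Complex.DeMoivre inj_on_def mult_ac)
    qed (use w0 in \<open>simp add: q_def\<close>)
    show ?thesis
      using sum_powers_root_of_unity[OF qK] q1 by (auto simp: summand)
  qed
  define P where "P z = (\<Sum>n<K. scaleC (z ^ n) (c n))" for z
  have "(\<Sum>j<K. scaleC (inverse (w ^ j) ^ m) (P (of_real r * w ^ j)))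
      = (\<Sum>j<K. \<Sum>n<K. scaleC (of_real r ^ n * (inverse (w ^ j) ^ m * (w ^ j) ^ n)) (c n))"
    by (simp add: P_def scaleC_sum_right scaleC_scaleC power_mult_distrib mult_ac)
  also have "\<dots> = (\<Sum>n<K. scaleC (of_real r ^ n * (\<Sum>j<K. inverse (w ^ j) ^ m * (w ^ j) ^ n)) (c n))"
    by (subst sum.swap) (simp add: scaleC_sum_left sum_distrib_left)
  also have "\<dots> = (\<Sum>n<K. if n = m then scaleC (of_real r ^ m * of_nat K) (c m) else 0)"
    by (rule sum.cong) (auto simp: orth scaleC_zero_left)
  also have "\<dots> = scaleC (of_real r ^ m * of_nat K) (c m)"
    using assms(1) by simp
  finally have avg: "scaleC (of_real r ^ m * of_nat K) (c m)
      = (\<Sum>j<K. scaleC (inverse (w ^ j) ^ m) (P (of_real r * w ^ j)))" by simp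
  have nw: "cmod w = 1" by (simp add: w_def)
  have "norm (scaleC (of_real r ^ m * of_nat K) (c m)) \<le> (\<Sum>j<K. B)"
    unfolding avg
  proof (rule sum_norm_le)
    fix j
    have "norm (P (of_real r * w ^ j)) \<le> B"
      unfolding P_def by (rule bound) (simp add: norm_mult norm_power nw assms(2))
    thus "norm (scaleC (inverse (w ^ j) ^ m) (P (of_real r * w ^ j))) \<le> B"
      by (simp add: norm_scaleC norm_power norm_inverse nw)
  qed
  hence "real K * (r ^ m * norm (c m)) \<le> real K * B"
    using assms(2) by (simp add: norm_scaleC norm_mult norm_power mult_ac)
  thus ?thesis using K by simp
qed

text \<open>
  On the circle of radius \<open>r\<close> the partial sum of length \<open>K\<close> differs from the series by at most the tail
  \<open>R K\<close> of the majorant, so the estimate for polynomials gives \<open>r\<^sup>m \<parallel>c\<^sub>m\<parallel> \<le> B + R K\<close>. Letting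
  \<open>K\<close> and then \<open>r\<close> tend to infinity forces \<open>c\<^sub>m = 0\<close>.
\<close>

lemma bounded_power_series_coeff_zero:
  fixes c :: "nat \<Rightarrow> 'a::unital_cstar_algebra"
  assumes summable: "\<And>r. r \<ge> 0 \<Longrightarrow> summable (\<lambda>n. r ^ n * norm (c n))"
    and bound: "\<And>z. norm (\<Sum>n. scaleC (z ^ n) (c n)) \<le> B"
    and "m > 0"
  shows "c m = 0"
proof -
  have est: "r ^ m * norm (c m) \<le> B" if r: "r \<ge> 0" for r
  proof -
    define R where "R K = (\<Sum>n. r ^ (n + K) * norm (c (n + K)))" for K
    have R0: "R \<longlonglongrightarrow> 0"
      unfolding R_def by (rule suminf_exist_split2[OF summable[OF r]])
    have le: "r ^ m * norm (c m) \<le> B + R K" if "m < K" for K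
    proof (rule polynomial_Cauchy_estimate[OF that r])
      fix z assume z: "cmod z = r"
      let ?f = "\<lambda>n. scaleC (z ^ n) (c n)"
      have nf: "norm (?f n) = r ^ n * norm (c n)" for n
        by (simp add: norm_scaleC norm_power z)
      have sn: "summable (\<lambda>n. norm (?f n))" by (simp add: nf summable[OF r])
      have tail: "norm (\<Sum>n. ?f (n + K)) \<le> R K"
        using summable_norm[of "\<lambda>n. ?f (n + K)"] summable_ignore_initial_segment[OF sn, of K]
        by (simp add: nf R_def)
      have "(\<Sum>n<K. ?f n) = (\<Sum>n. ?f n) - (\<Sum>n. ?f (n + K))"
        using suminf_split_initial_segment[OF summable_norm_cancel[OF sn], of K] by simp
      thus "norm (\<Sum>n<K. ?f n) \<le> B + R K"
        using norm_triangle_ineq4[of "\<Sum>n. ?f n" "\<Sum>n. ?f (n + K)"] bound[of z] tail by simp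
    qed
    have "(\<lambda>K. B + R K) \<longlonglongrightarrow> B + 0" by (intro tendsto_intros R0)
    moreover have "\<exists>K0. \<forall>K\<ge>K0. r ^ m * norm (c m) \<le> B + R K"
      using le Suc_le_lessD by blast
    ultimately have "r ^ m * norm (c m) \<le> B + 0" by (rule LIMSEQ_le_const)
    thus ?thesis by simp
  qed
  show ?thesis
  proof (rule ccontr)
    assume "c m \<noteq> 0"
    hence n: "norm (c m) > 0" by simp
    \<comment> \<open>Since \<open>r \<ge> 1\<close>, \<open>r\<close> is at most \<open>r\<^sup>m\<close>, so it suffices that \<open>r \<parallel>c\<^sub>m\<parallel>\<close> exceeds \<open>B\<close>.\<close>
    define r where "r = 1 + \<bar>B\<bar> / norm (c m)"
    have r1: "r \<ge> 1" using n by (simp add: r_def)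
    have "r * norm (c m) = norm (c m) + \<bar>B\<bar>" using n by (simp add: r_def distrib_right)
    hence "B < r * norm (c m)" using n by linarith
    also have "\<dots> \<le> r ^ m * norm (c m)"
      using self_le_power[OF r1 \<open>m > 0\<close>] n by simp
    also have "\<dots> \<le> B" using est r1 by simp
    finally show False by simp
  qed
qed

section \<open>The Fuglede--Putnam theorem\<close>

text \<open>
  The Cauchy product of the two exponential series, with \<open>v\<close> attached to the left one: all terms of
  total degree \<open>n\<close> carry the same scalar \<open>z\<^sup>n\<close>. The product of the majorants at \<open>\<bar>z\<bar> = r\<close> gives the
  absolute convergence.
\<close>

lemma exp_sandwich_power_series:
  fixes a b v :: "'a::unital_cstar_algebra"
  defines "c \<equiv> \<lambda>n. \<Sum>i\<le>n. (a ^ i /\<^sub>R fact i * v) * (b ^ (n - i) /\<^sub>R fact (n - i))"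
  shows "(\<lambda>n. scaleC (z ^ n) (c n)) sums (exp (scaleC z a) * v * exp (scaleC z b))"
    and "r \<ge> 0 \<Longrightarrow> summable (\<lambda>n. r ^ n * norm (c n))"
proof -
  have summand: "(scaleC z a ^ i /\<^sub>R fact i * v) * (scaleC z b ^ j /\<^sub>R fact j)
      = scaleC (z ^ (i + j)) ((a ^ i /\<^sub>R fact i * v) * (b ^ j /\<^sub>R fact j))" for z i j
    by (simp add: scaleC_power scaleR_scaleC scaleC_scaleC mult_scaleC_left mult_scaleC_right
        power_add mult_ac)
  have coeff: "(\<Sum>i\<le>n. (scaleC z a ^ i /\<^sub>R fact i * v) * (scaleC z b ^ (n - i) /\<^sub>R fact (n - i)))
      = scaleC (z ^ n) (c n)" for z n
    unfolding c_def scaleC_sum_right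
    by (rule sum.cong) (simp_all only: summand atMost_iff le_add_diff_inverse)
  have bd: "summable (\<lambda>n. norm (x ^ n /\<^sub>R fact n * v))" for x
  proof (rule summable_comparison_test')
    show "summable (\<lambda>n. norm (x ^ n /\<^sub>R fact n) * norm v)"
      by (rule summable_mult2[OF summable_norm_exp])
  qed (use norm_mult_ineq[of "x ^ _ /\<^sub>R fact _" v] in simp)
  have "(\<lambda>n. scaleC z a ^ n /\<^sub>R fact n * v) sums (exp (scaleC z a) * v)"
    by (rule sums_mult2[OF exp_converges])
  hence eqa: "(\<Sum>n. scaleC z a ^ n /\<^sub>R fact n * v) = exp (scaleC z a) * v"
    by (rule sums_unique[symmetric])
  have eqb: "(\<Sum>n. scaleC z b ^ n /\<^sub>R fact n) = exp (scaleC z b)"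
    by (rule sums_unique[OF exp_converges, symmetric])
  show "(\<lambda>n. scaleC (z ^ n) (c n)) sums (exp (scaleC z a) * v * exp (scaleC z b))"
    using Cauchy_product_sums[OF bd[of "scaleC z a"] summable_norm_exp[of "scaleC z b"]]
    unfolding coeff eqa eqb .
  assume r: "r \<ge> 0"
  let ?A = "\<lambda>n. norm ((r *\<^sub>R a) ^ n /\<^sub>R fact n * v)"
  let ?B = "\<lambda>n. norm ((r *\<^sub>R b) ^ n /\<^sub>R fact n)"
  have "summable (\<lambda>n. \<Sum>i\<le>n. ?A i * ?B (n - i))"
    using bd[of "r *\<^sub>R a"] summable_norm_exp[of "r *\<^sub>R b"]
    by (intro summable_Cauchy_product) (simp_all only: real_norm_def abs_norm_cancel)
  thus "summable (\<lambda>n. r ^ n * norm (c n))"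
  proof (rule summable_comparison_test'[where N = 0])
    fix n
    have "r ^ n * norm (c n) = norm (scaleC (of_real r ^ n) (c n))"
      using r by (simp add: norm_scaleC norm_power)
    also have "\<dots> \<le> (\<Sum>i\<le>n. ?A i * ?B (n - i))"
      unfolding coeff[symmetric] scaleR_scaleC[symmetric]
      by (intro sum_norm_le norm_mult_ineq)
    finally show "norm (r ^ n * norm (c n)) \<le> (\<Sum>i\<le>n. ?A i * ?B (n - i))"
      using r by simp
  qed
qed

text \<open>
  From \<open>N v = v M\<close> one gets \<open>v = exp (- cnj z N) v exp (cnj z M)\<close>. Inserting this and merging
  exponentials, which is possible by normality, turns the expression into
  \<open>exp s * v * exp t\<close> with \<open>s\<close> and \<open>t\<close> skew-adjoint, and the exponential of a skew-adjoint element is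
  unitary. Using \<open>cnj z\<close> rather than \<open>z\<close> is what makes \<open>s\<close> and \<open>t\<close> skew-adjoint.
\<close>

lemma norm_exp_sandwich_le:
  fixes N M v :: "'a::unital_cstar_algebra"
  assumes N: "N * star N = star N * N" and M: "M * star M = star M * M"
    and v: "N * v = v * M"
  shows "norm (exp (scaleC z (star N)) * v * exp (scaleC z (- star M))) \<le> norm v"
proof -
  define s t where "s = scaleC z (star N) - scaleC (cnj z) N"
    and "t = scaleC (cnj z) M - scaleC z (star M)"
  have skew: "star s = - s" "star t = - t"
    by (simp_all add: s_def t_def star_diff star_scaleC star_star)
  have es: "exp (scaleC z (star N)) = exp s * exp (scaleC (cnj z) N)"
  proof -
    have "s * scaleC (cnj z) N = scaleC (cnj z) N * s"
      by (simp add: s_def algebra_simps mult_scaleC_left mult_scaleC_right scaleC_diff_right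
          scaleC_scaleC N)
    from exp_add_commuting[OF this] show ?thesis by (simp add: s_def)
  qed
  have et: "exp (scaleC (cnj z) M) * exp (scaleC z (- star M)) = exp t"
  proof -
    have "scaleC (cnj z) M * scaleC z (- star M) = scaleC z (- star M) * scaleC (cnj z) M"
      by (simp add: scaleC_minus_right mult_scaleC_left mult_scaleC_right scaleC_scaleC M mult.commute)
    from exp_add_commuting[OF this] show ?thesis by (simp add: t_def scaleC_minus_right)
  qed
  have "exp (scaleC (cnj z) N) * v = v * exp (scaleC (cnj z) M)"
    by (rule exp_intertwine) (simp add: mult_scaleC_left mult_scaleC_right v)
  hence "exp (scaleC z (star N)) * v * exp (scaleC z (- star M)) = exp s * v * exp t"
    unfolding es et[symmetric] by (simp add: mult.assoc)
  also have "norm \<dots> \<le> norm (exp s) * norm v * norm (exp t)"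
    by (meson norm_mult_ineq order_trans mult_right_mono norm_ge_zero)
  finally show ?thesis by (simp add: norm_exp_skew_adjoint skew)
qed

text \<open>
  The coefficient of \<open>z\<close> in the bounded entire function \<open>exp (z N\<^sup>*) v exp (- z M\<^sup>*)\<close> is
  \<open>N\<^sup>* v - v M\<^sup>*\<close>.
\<close>

theorem Fuglede_Putnam:
  fixes N M v :: "'a::unital_cstar_algebra"
  assumes "N * star N = star N * N" and "M * star M = star M * M"
    and "N * v = v * M"
  shows "star N * v = v * star M"
proof -
  define c where "c n = (\<Sum>i\<le>n. (star N ^ i /\<^sub>R fact i * v)
      * ((- star M) ^ (n - i) /\<^sub>R fact (n - i)))" for n
  note series = exp_sandwich_power_series[where a = "star N" and v = v and b = "- star M", folded c_def]
  have "c 1 = 0"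
  proof (rule bounded_power_series_coeff_zero)
    show "norm (\<Sum>n. scaleC (z ^ n) (c n)) \<le> norm v" for z
      using norm_exp_sandwich_le[OF assms, of z] sums_unique[OF series(1), of z] by simp
  qed (simp_all add: series(2))
  moreover have "c 1 = star N * v - v * star M"
    by (simp add: c_def)
  ultimately show ?thesis by simp
qed

section \<open>Commutants and maximal abelian subalgebras\<close>

lemma cstar_subalgebra_commutant:
  assumes star: "\<And>x. x \<in> S \<Longrightarrow> star x \<in> S"
  shows "cstar_subalgebra (commutant (S :: 'a::unital_cstar_algebra set))"
proof -
  have "closed (commutant S)"
  proof -
    have "commutant S = (\<Inter>d\<in>S. {x. x * d = d * x})" by (auto simp: commutant_def)
    moreover have "closed {x. x * d = d * x}" for d :: 'a
      by (intro closed_Collect_eq continuous_intros)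
    ultimately show ?thesis by (simp add: closed_INT)
  qed
  moreover have "x * y \<in> commutant S" if "x \<in> commutant S" "y \<in> commutant S" for x y
    unfolding commutant_def
  proof safe
    fix d assume "d \<in> S"
    with that have d: "x * d = d * x" "y * d = d * y" by (simp_all add: commutant_def)
    show "x * y * d = d * (x * y)" by (metis d mult.assoc)
  qed
  moreover have "star x \<in> commutant S" if x: "x \<in> commutant S" for x
    unfolding commutant_def
  proof safe
    fix d assume "d \<in> S"
    with x star have "star (x * star d) = star (star d * x)" by (simp add: commutant_def)
    thus "star x * d = d * star x" by (simp add: star_mult star_star)
  qed
  ultimately show ?thesis
    by (auto simp: cstar_subalgebra_def commutant_def algebra_simps
        mult_scaleC_left mult_scaleC_right)
qed

lemma subset_double_commutant: "S \<subseteq> commutant (commutant S)"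
  by (auto simp: commutant_def)

text \<open>
  An abelian \<open>S\<close> lies in its commutant, so the double commutant of \<open>S\<close> lies in the commutant too and
  therefore commutes with itself.
\<close>

lemma abelian_double_commutant:
  assumes "abelian S"
  shows "abelian (commutant (commutant S))"
  using assms unfolding abelian_def commutant_def by blast

text \<open>
  The double commutant of \<open>D \<union> {h}\<close> serves as an abelian \<open>C\<^sup>*\<close>-subalgebra containing both \<open>D\<close> and
  \<open>h\<close>; it must then equal \<open>D\<close>. Self-adjointness of \<open>h\<close> makes \<open>D \<union> {h}\<close> closed under the
  involution, and hence its commutants as well.
\<close>

lemma maximal_abelian_self_adjoint_mem:
  assumes D: "maximal_abelian D" and h: "star h = h" "h \<in> commutant D"
  shows "h \<in> D"
proof -
  let ?S = "insert h D" and ?E = "commutant (commutant (insert h D))"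
  have star: "star x \<in> ?S" if "x \<in> ?S" for x
    using that D h by (auto simp: maximal_abelian_def cstar_subalgebra_def)
  have "cstar_subalgebra (commutant ?S)"
    by (rule cstar_subalgebra_commutant) (rule star)
  hence "cstar_subalgebra ?E"
    by (intro cstar_subalgebra_commutant) (auto simp: cstar_subalgebra_def)
  moreover have "abelian ?S"
    using D h by (auto simp: abelian_def maximal_abelian_def commutant_def)
  hence "abelian ?E" by (rule abelian_double_commutant)
  moreover have "?S \<subseteq> ?E" by (rule subset_double_commutant)
  ultimately show ?thesis using D unfolding maximal_abelian_def by blast
qed

section \<open>Intertwiners\<close>

text \<open>
  The adjoint of the relation \<open>N\<^sup>* v = v M\<^sup>*\<close> supplied by Fuglede--Putnam reads
  \<open>v\<^sup>* N = M v\<^sup>*\<close>; the other two identities are obtained by moving \<open>N\<close> or \<open>M\<close> past both factors.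
\<close>

lemma intertwine_star_mult_commute:
  fixes N M v :: "'a::unital_cstar_algebra"
  assumes "N * star N = star N * N" and "M * star M = star M * M"
    and v: "N * v = v * M"
  shows "star v * N = M * star v" "star v * v * M = M * (star v * v)"
    "v * star v * N = N * (v * star v)"
proof -
  have "star (star N * v) = star (v * star M)"
    using Fuglede_Putnam[OF assms] by simp
  thus *: "star v * N = M * star v" by (simp add: star_mult star_star)
  show "star v * v * M = M * (star v * v)" by (metis * v mult.assoc)
  show "v * star v * N = N * (v * star v)" by (metis * v mult.assoc)
qed

theorem proposition3p2:
  fixes D :: "'a::unital_cstar_algebra set" and v :: 'a
  assumes "cstar_subalgebra D" and "abelian D" and "1 \<in> D"
    and "intertwiner D v"
  shows "star v * v \<in> commutant D \<and> v * star v \<in> commutant D \<and>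
         (maximal_abelian D \<longrightarrow> normalizer D v)"
proof -
  have normal: "d * star d = star d * d" if "d \<in> D" for d
    using that assms(1,2) by (auto simp: cstar_subalgebra_def abelian_def)
  have right: "\<exists>e\<in>D. e * v = v * d" and left: "\<exists>e\<in>D. d * v = v * e" if "d \<in> D" for d
  proof -
    have "v * d \<in> (\<lambda>d. d * v) ` D" "d * v \<in> (\<lambda>d. v * d) ` D"
      using that assms(4) unfolding intertwiner_def by blast+
    thus "\<exists>e\<in>D. e * v = v * d" "\<exists>e\<in>D. d * v = v * e" by (auto simp: image_iff)
  qed
  note comm = intertwine_star_mult_commute[OF normal normal]
  have vv: "star v * v \<in> commutant D"
    unfolding commutant_def using right comm(2) by blast
  have vv': "v * star v \<in> commutant D"
    unfolding commutant_def using left comm(3) by blast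
  have "normalizer D v" if D: "maximal_abelian D"
  proof -
    have mem: "star v * v \<in> D" "v * star v \<in> D"
      by (rule maximal_abelian_self_adjoint_mem[OF D]; simp add: vv vv' star_mult star_star)+
    have closed: "x * y \<in> D" if "x \<in> D" "y \<in> D" for x y
      using that assms(1) by (auto simp: cstar_subalgebra_def)
    have "v * d * star v \<in> D" if d: "d \<in> D" for d
    proof -
      obtain e where "e \<in> D" "e * v = v * d" using right[OF d] by blast
      thus ?thesis using closed[OF _ mem(2)] by (metis mult.assoc)
    qed
    moreover have "star v * d * v \<in> D" if d: "d \<in> D" for d
    proof -
      obtain e where e: "e \<in> D" "d * v = v * e" using left[OF d] by blast
      thus ?thesis using closed[OF _ mem(1)] comm(1)[OF d e] by (metis mult.assoc)
    qed
    ultimately show ?thesis by (auto simp: normalizer_def)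
  qed
  with vv vv' show ?thesis by blast
qed

end
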